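(* Let $G$ be a finite simple connected graph with non-empty vertex set. Then the following statements are equivalent: (i) $G$ is square-stable, i.e. $\alpha(G)=\alpha(G^2)$; (ii) there exists $S_0\in\Omega(G)$ that has property P2; (iii) every $S\in\Omega(G^2)$ has property P2.
   Context: $G^2$ is the graph on $V(G)$ in which distinct vertices $v,w$ are adjacent iff $\mathrm{dist}_G(v,w)\le 2$. A stable set is a set of pairwise non-adjacent vertices; $\alpha(G)$ is the maximum cardinality of a stable set; $\Omega(G)$ is the set of all maximum (cardinality) stable sets of $G$. A stable set $S$ of $G$ has property P2 if for every stable set $A$ of $G$ disjoint from $S$ there is a (not necessarily proper) subset $S^*\subseteq S$ such that $A\cup S^*\in\Omega(G)$. *)

theory Defs
  imports "Graph_Theory.Graph_Theory"
begin

text \<open>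
  A finite simple graph is a \<^locale>\<open>pair_graph\<close>: a finite vertex set together with a
  symmetric, irreflexive set of arcs, where the edge \<open>{u, v}\<close> is represented by the two arcs
  \<open>(u, v)\<close> and \<open>(v, u)\<close>.
\<close>

text \<open>
  The distance is the infimum of the costs of all walks where every arc costs 1, i.e. the least
  length of a walk, and \<open>\<infinity>\<close> if there is none.
\<close>
definition gdist :: "'a pair_pre_digraph \<Rightarrow> 'a \<Rightarrow> 'a \<Rightarrow> ereal" where
  "gdist G u v = wf_digraph.\<mu> (with_proj G) (\<lambda>_. 1) u v"

definition square :: "'a pair_pre_digraph \<Rightarrow> 'a pair_pre_digraph" where
  "square G = \<lparr> pverts = pverts G,
     parcs = {(v, w). v \<in> pverts G \<and> w \<in> pverts G \<and> v \<noteq> w \<and> gdist G v w \<le> 2} \<rparr>"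

definition stable :: "'a pair_pre_digraph \<Rightarrow> 'a set \<Rightarrow> bool" where
  "stable G S \<longleftrightarrow> S \<subseteq> pverts G \<and> pairwise (\<lambda>u v. (u, v) \<notin> parcs G) S"

definition stability_number :: "'a pair_pre_digraph \<Rightarrow> nat" where
  "stability_number G = Max (card ` {S. stable G S})"

definition max_stable_sets :: "'a pair_pre_digraph \<Rightarrow> 'a set set" where
  "max_stable_sets G = {S. stable G S \<and> card S = stability_number G}"

definition square_stable :: "'a pair_pre_digraph \<Rightarrow> bool" where
  "square_stable G \<longleftrightarrow> stability_number G = stability_number (square G)"

definition property_P2 :: "'a pair_pre_digraph \<Rightarrow> 'a set \<Rightarrow> bool" where
  "property_P2 G S \<longleftrightarrow> stable G S \<and>
     (\<forall>A. stable G A \<and> A \<inter> S = {} \<longrightarrow> (\<exists>T\<subseteq>S. A \<union> T \<in> max_stable_sets G))"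

end

theory Submission
  imports Defs
begin

text \<open>
  A set is stable in \<open>G\<^sup>2\<close> iff it is stable in \<open>G\<close> and no vertex has two neighbours in it
  (\<open>stable_square_iff\<close>). In particular \<open>\<alpha>(G\<^sup>2) \<le> \<alpha>(G)\<close>, and \<open>G\<close> is square-stable iff some, and then
  every, maximum stable set of \<open>G\<^sup>2\<close> is a maximum stable set of \<open>G\<close>. Property P2 is the exchange
  property that matches the condition on neighbours:

  \<^item> If \<open>S \<in> \<Omega>(G)\<close> is stable in \<open>G\<^sup>2\<close>, a stable set \<open>A\<close> disjoint from \<open>S\<close> has at most \<open>|A|\<close>
    neighbours in \<open>S\<close>. Exchanging these neighbours for \<open>A\<close> does not decrease the cardinality
    (\<open>property_P2_if_stable_square\<close>).

  \<^item> If \<open>S \<in> \<Omega>(G)\<close> has property P2 and a vertex \<open>x\<close> had two neighbours in \<open>S\<close>, then extending \<open>{x}\<close>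
    by vertices of \<open>S\<close> would give at most \<open>1 + (\<alpha>(G) - 2)\<close> vertices; hence \<open>S\<close> is stable in \<open>G\<^sup>2\<close>
    (\<open>stable_square_if_property_P2\<close>).

  The set \<open>A = {}\<close> shows that a set with property P2 contains a maximum stable set of \<open>G\<close>, so it is
  itself maximum. This leads from a maximum stable set of \<open>G\<^sup>2\<close> with property P2 back to
  \<open>\<alpha>(G) = \<alpha>(G\<^sup>2)\<close>.
\<close>

lemma pverts_square [simp]: "pverts (square G) = pverts G"
  by (simp add: square_def)

lemma finite_stable_sets:
  assumes "finite (pverts G)"
  shows "finite {S. stable G S}"
  by (rule finite_subset[of _ "Pow (pverts G)"]) (auto simp: stable_def assms)

lemma card_le_stability_number:
  assumes "finite (pverts G)" "stable G S"
  shows "card S \<le> stability_number G"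
  unfolding stability_number_def
  by (rule Max_ge) (use assms finite_stable_sets in auto)

lemma max_stable_setI:
  assumes "finite (pverts G)" "stable G S" "stability_number G \<le> card S"
  shows "S \<in> max_stable_sets G"
  using assms card_le_stability_number[of G S] by (simp add: max_stable_sets_def)

lemma max_stable_sets_nonempty:
  assumes "finite (pverts G)"
  shows "max_stable_sets G \<noteq> {}"
proof -
  have "stable G {}"
    by (simp add: stable_def)
  then have "stability_number G \<in> card ` {S. stable G S}"
    unfolding stability_number_def
    by (intro Max_in) (use finite_stable_sets[OF assms] in auto)
  then show ?thesis
    by (auto simp: max_stable_sets_def)
qed

text \<open>
  The infimum that defines the distance need not be attained a priori. But if no walk of length at
  most 2 existed, every walk would cost at least 3, and so would the infimum.
\<close>

lemma (in pair_wf_digraph) gdist_le_2_iff: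
  assumes "u \<in> pverts G"
  shows "gdist G u v \<le> 2 \<longleftrightarrow>
    u = v \<or> (u, v) \<in> parcs G \<or> (\<exists>x. (u, x) \<in> parcs G \<and> (x, v) \<in> parcs G)"
proof -
  have cost: "awalk_cost (\<lambda>_. 1) p = real (length p)" for p
    by (simp add: awalk_cost_def sum_list_triv)
  have "gdist G u v \<le> 2 \<longleftrightarrow> (\<exists>p. awalk u p v \<and> length p \<le> 2)"
  proof
    assume le: "gdist G u v \<le> 2"
    show "\<exists>p. awalk u p v \<and> length p \<le> 2"
    proof (rule ccontr)
      assume "\<not> ?thesis"
      then have "3 \<le> gdist G u v"
        unfolding gdist_def \<mu>_def cost by (intro INF_greatest) fastforce
      then have "(3 :: ereal) \<le> 2"
        using le by (rule order_trans)
      then show False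
        by simp
    qed
  next
    assume "\<exists>p. awalk u p v \<and> length p \<le> 2"
    then obtain p where "awalk u p v" "length p \<le> 2"
      by blast
    then have "gdist G u v \<le> ereal (real (length p))" "ereal (real (length p)) \<le> 2"
      using min_cost_le_walk_cost[of u p v "\<lambda>_. 1"] by (simp_all add: gdist_def cost)
    then show "gdist G u v \<le> 2"
      by (rule order_trans)
  qed
  also have "\<dots> \<longleftrightarrow> u = v \<or> (u, v) \<in> parcs G \<or> (\<exists>x. (u, x) \<in> parcs G \<and> (x, v) \<in> parcs G)"
  proof
    assume "\<exists>p. awalk u p v \<and> length p \<le> 2"
    then obtain p where "awalk u p v" "length p \<le> 2"
      by blast
    then show "u = v \<or> (u, v) \<in> parcs G \<or> (\<exists>x. (u, x) \<in> parcs G \<and> (x, v) \<in> parcs G)"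
      by (cases p rule: remdups_adj.cases) (auto simp: awalk_simps)
  next
    assume "u = v \<or> (u, v) \<in> parcs G \<or> (\<exists>x. (u, x) \<in> parcs G \<and> (x, v) \<in> parcs G)"
    then consider "u = v" | "(u, v) \<in> parcs G" | x where "(u, x) \<in> parcs G" "(x, v) \<in> parcs G"
      by blast
    then show "\<exists>p. awalk u p v \<and> length p \<le> 2"
    proof cases
      case 1
      then show ?thesis
        using assms by (intro exI[of _ "[]"]) (simp add: awalk_simps)
    next
      case 2
      then show ?thesis
        by (intro exI[of _ "[(u, v)]"]) (auto simp: awalk_simps dest: wellformed')
    next
      case 3
      then show ?thesis
        by (intro exI[of _ "[(u, x), (x, v)]"]) (auto simp: awalk_simps dest: wellformed')
    qed
  qed
  finally show ?thesis .
qed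

lemma (in pair_wf_digraph) stable_square_iff:
  "stable (square G) S \<longleftrightarrow> stable G S \<and>
    (\<forall>v\<in>S. \<forall>w\<in>S. \<forall>x. (v, x) \<in> parcs G \<longrightarrow> (x, w) \<in> parcs G \<longrightarrow> v = w)"
proof (cases "S \<subseteq> pverts G")
  case True
  then have "(v, w) \<in> parcs (square G) \<longleftrightarrow> v \<noteq> w \<and>
      ((v, w) \<in> parcs G \<or> (\<exists>x. (v, x) \<in> parcs G \<and> (x, w) \<in> parcs G))"
    if "v \<in> S" "w \<in> S" for v w
  proof -
    have "v \<in> pverts G" "w \<in> pverts G"
      using that True by auto
    then show ?thesis
      using gdist_le_2_iff[of v w] unfolding square_def by (simp only: pair_pre_digraph.simps) blast
  qed
  then show ?thesis
    using True by (simp add: stable_def pairwise_def) blast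
qed (simp add: stable_def)

lemma (in pair_fin_digraph) stability_number_square_le:
  "stability_number (square G) \<le> stability_number G"
proof -
  obtain S where "S \<in> max_stable_sets (square G)"
    using max_stable_sets_nonempty[of "square G"] pair_finite_verts by auto
  then show ?thesis
    using card_le_stability_number[of G S] pair_finite_verts
    by (auto simp: max_stable_sets_def stable_square_iff)
qed

text \<open>
  Since each vertex has at most one neighbour in \<open>S\<close>, the neighbours in \<open>S\<close> of a stable set \<open>A\<close>
  inject into \<open>A\<close>; replacing them by \<open>A\<close> is the exchange that property P2 asks for.
\<close>

lemma (in pair_pseudo_graph) property_P2_if_stable_square:
  assumes S: "stable (square G) S" and card_S: "card S = stability_number G"
  shows "property_P2 G S"
  unfolding property_P2_def
proof (intro conjI allI impI)
  show stable_S: "stable G S"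
    using S by (simp add: stable_square_iff)
  fix A assume "stable G A \<and> A \<inter> S = {}"
  then have A: "stable G A" "A \<inter> S = {}"
    by simp_all
  have finite: "finite S" "finite A"
    using stable_S A(1) pair_finite_verts by (auto simp: stable_def intro: finite_subset)
  define N where "N = {s \<in> S. \<exists>a\<in>A. (s, a) \<in> parcs G}"
  have "N \<subseteq> S"
    by (auto simp: N_def)
  have "\<forall>s\<in>N. \<exists>a. a \<in> A \<and> (s, a) \<in> parcs G"
    by (auto simp: N_def)
  then obtain f where f: "\<And>s. s \<in> N \<Longrightarrow> f s \<in> A" "\<And>s. s \<in> N \<Longrightarrow> (s, f s) \<in> parcs G"
    using bchoice[of N "\<lambda>s a. a \<in> A \<and> (s, a) \<in> parcs G"] by blast
  have "inj_on f N"
  proof (rule inj_onI)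
    fix s t assume st: "s \<in> N" "t \<in> N" "f s = f t"
    then have "(s, f s) \<in> parcs G" "(f s, t) \<in> parcs G"
      using f[of s] f[of t] arcs_symmetric by auto
    then show "s = t"
      using S st \<open>N \<subseteq> S\<close> by (auto simp: stable_square_iff)
  qed
  then have card_N: "card N \<le> card A"
    using f(1) finite(2) by (intro card_inj_on_le[of f]) auto
  have "card S = card N + card (S - N)"
    using finite \<open>N \<subseteq> S\<close> by (simp add: card_Diff_subset card_mono finite_subset)
  also have "\<dots> \<le> card A + card (S - N)"
    using card_N by simp
  also have "\<dots> = card (A \<union> (S - N))"
    using finite A(2) by (subst card_Un_disjoint) auto
  finally have "stability_number G \<le> card (A \<union> (S - N))"
    by (simp add: card_S)
  moreover have "stable G (A \<union> (S - N))"
    using A(1) stable_S arcs_symmetric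
    by (auto simp: stable_def pairwise_def N_def)
  ultimately have "A \<union> (S - N) \<in> max_stable_sets G"
    using pair_finite_verts by (intro max_stable_setI)
  then show "\<exists>T\<subseteq>S. A \<union> T \<in> max_stable_sets G"
    by blast
qed

text \<open>
  Property P2 for the empty set already gives a maximum stable set inside \<open>S\<close>.
\<close>

lemma property_P2_imp_max_stable_set:
  assumes "finite (pverts G)" "property_P2 G S"
  shows "S \<in> max_stable_sets G"
proof -
  have S: "stable G S"
    using assms by (simp add: property_P2_def)
  have "stable G {}"
    by (simp add: stable_def)
  then obtain T where "T \<subseteq> S" "T \<in> max_stable_sets G"
    using assms(2) by (auto simp: property_P2_def)
  moreover have "finite S"
    using S assms(1) by (auto simp: stable_def intro: finite_subset)
  ultimately show ?thesis
    using S assms(1) card_mono[of S T]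
    by (intro max_stable_setI) (auto simp: max_stable_sets_def)
qed

text \<open>
  A vertex \<open>x\<close> with two neighbours \<open>v\<close> and \<open>w\<close> in \<open>S\<close> violates property P2 for \<open>{x}\<close>: every stable
  extension of \<open>{x}\<close> by vertices of \<open>S\<close> loses both \<open>v\<close> and \<open>w\<close> and gains only \<open>x\<close>.
\<close>

lemma (in pair_graph) stable_square_if_property_P2:
  assumes P2: "property_P2 G S"
  shows "stable (square G) S"
  unfolding stable_square_iff
proof (intro conjI ballI allI impI)
  show S: "stable G S"
    using P2 by (simp add: property_P2_def)
  fix v w x assume vw: "v \<in> S" "w \<in> S" and x: "(v, x) \<in> parcs G" "(x, w) \<in> parcs G"
  have S_max: "card S = stability_number G"
    using property_P2_imp_max_stable_set[OF pair_finite_verts P2]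
    by (simp add: max_stable_sets_def)
  have "finite S"
    using S pair_finite_verts by (auto simp: stable_def intro: finite_subset)
  have "v \<noteq> x" "x \<noteq> w"
    using x no_loops' by auto
  show "v = w"
  proof (rule ccontr)
    assume "v \<noteq> w"
    have "x \<notin> S"
      using S vw(1) x(1) \<open>v \<noteq> x\<close> by (auto simp: stable_def pairwise_def)
    have "stable G {x}"
      using x wellformed' by (auto simp: stable_def pairwise_def)
    then obtain T where T: "T \<subseteq> S" "{x} \<union> T \<in> max_stable_sets G"
      using P2 \<open>x \<notin> S\<close> by (auto simp: property_P2_def)
    then have "v \<notin> T" "w \<notin> T"
      using x \<open>v \<noteq> x\<close> \<open>x \<noteq> w\<close> by (auto simp: max_stable_sets_def stable_def pairwise_def)
    have "finite T"
      using T(1) \<open>finite S\<close> by (rule finite_subset)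
    have "card T + 2 = card (insert v (insert w T))"
      using \<open>finite T\<close> \<open>v \<notin> T\<close> \<open>w \<notin> T\<close> \<open>v \<noteq> w\<close> by simp
    also have "\<dots> \<le> card S"
      using T(1) vw \<open>finite S\<close> by (intro card_mono) auto
    also have "\<dots> = card ({x} \<union> T)"
      using T(2) S_max by (simp add: max_stable_sets_def)
    also have "\<dots> \<le> card T + 1"
      by (simp add: \<open>finite T\<close> card_insert_if)
    finally show False
      by simp
  qed
qed

theorem theorem2p13:
  fixes G :: "'a pair_pre_digraph"
  assumes "pair_graph G"
    and "pverts G \<noteq> {}"
    and "Digraph_Component.connected (with_proj G)"
  shows "(square_stable G \<longleftrightarrow> (\<exists>S\<^sub>0\<in>max_stable_sets G. property_P2 G S\<^sub>0)) \<and>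
         (square_stable G \<longleftrightarrow> (\<forall>S\<in>max_stable_sets (square G). property_P2 G S))"
proof -
  interpret pair_graph G by fact
  note fin = pair_finite_verts
  obtain S where S: "S \<in> max_stable_sets (square G)"
    using max_stable_sets_nonempty[of "square G"] fin by auto
  have i_iii: "\<forall>S\<in>max_stable_sets (square G). property_P2 G S" if "square_stable G"
    using that property_P2_if_stable_square by (auto simp: max_stable_sets_def square_stable_def)
  have iii_ii: "\<exists>S\<^sub>0\<in>max_stable_sets G. property_P2 G S\<^sub>0"
    if "\<forall>S\<in>max_stable_sets (square G). property_P2 G S"
    using that S property_P2_imp_max_stable_set[OF fin] by blast
  have ii_i: "square_stable G" if "\<exists>S\<^sub>0\<in>max_stable_sets G. property_P2 G S\<^sub>0"
    using that
  proof
    fix S\<^sub>0 assume "S\<^sub>0 \<in> max_stable_sets G" "property_P2 G S\<^sub>0"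
    then have "card S\<^sub>0 = stability_number G" "card S\<^sub>0 \<le> stability_number (square G)"
      using fin stable_square_if_property_P2 card_le_stability_number[of "square G" S\<^sub>0]
      by (simp_all add: max_stable_sets_def)
    then show ?thesis
      using stability_number_square_le by (simp add: square_stable_def)
  qed
  show ?thesis
    using i_iii iii_ii ii_i by blast
qed

end
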